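(* Let $(X,+)$ be a magma (a set with a binary operation) with a summation system $\Sigma$ such that: (i) whenever $(a_i)_{i\in\mathbb N}\in X^{\mathbb N}$ is summable and $\varphi$ is a permutation of $\mathbb N$, then $(a_{\varphi(i)})_{i\in\mathbb N}$ is summable with the same sum; (ii) whenever $(a_i)_{i\in\mathbb N}$ is summable, then so is $(a_{i+1})_{i\in\mathbb N}$, and $\Sigma(a_i)_{i\in\mathbb N}=a_0+\Sigma(a_{i+1})_{i\in\mathbb N}$; (iii) every family in $X^{\mathbb N}$ is summable. Then for any countable list of elements $x_0,x_1,\ldots\in X$, there exists an element $y\in X$ such that $x_i+y=y$ for each $i\in\mathbb N$.
   Context: $\mathbb N=\{0,1,2,\dots\}$. A summation system on a set $X$ is a partial function $\Sigma\colon\bigcup_I X^I\to X$, the union running over all sets $I$; a family is summable if it lies in $\mathrm{dom}(\Sigma)$. *)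

theory Defs
  imports Main
begin

text \<open>
  HOL has no collection of all sets, so index sets range over the subsets of an arbitrary type
  \<open>'i\<close>. A family in \<open>X\<^sup>I\<close> is a map \<open>'i \<rightharpoonup> 'a\<close> with domain \<open>I\<close>; hence the type \<open>'i \<rightharpoonup> 'a\<close> is
  the union of the \<open>X\<^sup>I\<close> over all \<open>I\<close>, and a summation system is a partial function from it to \<open>X\<close>.
\<close>

type_synonym ('i, 'a) summation_system = "('i \<rightharpoonup> 'a) \<rightharpoonup> 'a"

definition summable_family :: "('i, 'a) summation_system \<Rightarrow> ('i \<rightharpoonup> 'a) \<Rightarrow> bool" where
  "summable_family S f \<longleftrightarrow> f \<in> dom S"

text \<open>Unspecified when the family is not summable.\<close>

definition family_sum :: "('i, 'a) summation_system \<Rightarrow> ('i \<rightharpoonup> 'a) \<Rightarrow> 'a" where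
  "family_sum S f = the (S f)"

text \<open>
  The set of natural numbers enters the universe \<open>'i\<close> of indices as the range of an injection
  \<open>\<nu> :: nat \<Rightarrow> 'i\<close> (the identity if \<open>'i\<close> is \<open>nat\<close>); the following is the family \<open>(a\<^sub>n)\<close> with the
  index \<open>n\<close> represented by \<open>\<nu> n\<close>.
\<close>

definition nat_family :: "(nat \<Rightarrow> 'i) \<Rightarrow> (nat \<Rightarrow> 'a) \<Rightarrow> ('i \<rightharpoonup> 'a)" where
  "nat_family \<nu> a = (\<lambda>k. if k \<in> range \<nu> then Some (a (inv \<nu> k)) else None)"

end

theory Submission
  imports Defs "HOL-Library.Nat_Bijection"
begin

text \<open>
  Let \<open>y\<close> be the sum of a family in which every \<open>x\<^sub>i\<close> occurs infinitely often. Putting one more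
  \<open>x\<^sub>i\<close> in front of this family only permutes it, so \<open>x\<^sub>i + y = y\<close>.
\<close>

text \<open>Hilbert's hotel on the grid coded by \<open>prod_encode\<close>: index 0 is the
  newcomer, and \<open>Suc m\<close> is the old guest of cell \<open>m\<close>. The newcomer takes
  column 0 of row \<open>i\<close>, whose guests each move one column on; all other rows stay
  put.\<close>

definition cycle_row :: "nat \<Rightarrow> nat \<Rightarrow> nat" where
  "cycle_row i n = (case n of 0 \<Rightarrow> prod_encode (i, 0)
    | Suc m \<Rightarrow> (case prod_decode m of (j, k) \<Rightarrow>
        if j = i then prod_encode (i, Suc k) else m))"

lemma cycle_row_0 [simp]: "cycle_row i 0 = prod_encode (i, 0)"
  by (simp add: cycle_row_def)

lemma cycle_row_Suc_encode [simp]: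
  "cycle_row i (Suc (prod_encode (j, k))) =
    (if j = i then prod_encode (i, Suc k) else prod_encode (j, k))"
  by (simp add: cycle_row_def)

text \<open>Outside row \<open>i\<close> each cell keeps its old guest. Inside it the successors
  reach every column except 0, and index 0 fills that gap.\<close>

lemma bij_cycle_row: "bij (cycle_row i)"
proof (rule bijI)
  \<comment> \<open>Puts every argument into one of the two shapes covered by the simp rules for
    \<open>cycle_row\<close>.\<close>
  have cases: "n = 0 \<or> (\<exists>j k. n = Suc (prod_encode (j, k)))" for n
  proof (cases n)
    case (Suc m)
    then have "n = Suc (prod_encode (fst (prod_decode m), snd (prod_decode m)))"
      by simp
    then show ?thesis by blast
  qed simp
  show "inj (cycle_row i)"
  proof (rule injI)
    fix m n
    assume "cycle_row i m = cycle_row i n"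
    then show "m = n"
      using cases[of m] cases[of n] by (auto simp: prod_encode_eq split: if_splits)
  qed
  have "\<exists>n. cycle_row i n = prod_encode (j, k)" for j k
  proof (cases "j = i")
    case True
    show ?thesis
    proof (cases k)
      case 0
      then have "cycle_row i 0 = prod_encode (j, k)"
        using True by simp
      then show ?thesis ..
    next
      case (Suc l)
      then have "cycle_row i (Suc (prod_encode (i, l))) = prod_encode (j, k)"
        using True by simp
      then show ?thesis ..
    qed
  next
    case False
    then have "cycle_row i (Suc (prod_encode (j, k))) = prod_encode (j, k)"
      by simp
    then show ?thesis ..
  qed
  then have "\<exists>n. cycle_row i n = m" for m
    using prod_decode_inverse[of m] by (cases "prod_decode m") metis
  then show "surj (cycle_row i)"
    unfolding surj_def by metis
qed

text \<open>Old guests change at most their column, so a family depending only on the row does not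
  notice the move.\<close>

lemma row_cycle_row_Suc: "fst (prod_decode (cycle_row i (Suc n))) = fst (prod_decode n)"
  by (auto simp: cycle_row_def split: prod.split)

theorem theorem4p3:
  fixes S :: "('i, 'a::plus) summation_system"
    and \<nu> :: "nat \<Rightarrow> 'i"
    and x :: "nat \<Rightarrow> 'a"
  assumes index_inj: "inj \<nu>"
    and permutation: "\<And>(a :: nat \<Rightarrow> 'a) (\<phi> :: nat \<Rightarrow> nat).
      summable_family S (nat_family \<nu> a) \<Longrightarrow> bij \<phi> \<Longrightarrow>
        summable_family S (nat_family \<nu> (\<lambda>i. a (\<phi> i))) \<and>
        family_sum S (nat_family \<nu> (\<lambda>i. a (\<phi> i))) = family_sum S (nat_family \<nu> a)"
    and shift: "\<And>a :: nat \<Rightarrow> 'a.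
      summable_family S (nat_family \<nu> a) \<Longrightarrow>
        summable_family S (nat_family \<nu> (\<lambda>i. a (i + 1))) \<and>
        family_sum S (nat_family \<nu> a) = a 0 + family_sum S (nat_family \<nu> (\<lambda>i. a (i + 1)))"
    and all_summable: "\<And>a :: nat \<Rightarrow> 'a. summable_family S (nat_family \<nu> a)"
  shows "\<exists>y. \<forall>i. x i + y = y"
proof (intro exI allI)
  \<comment> \<open>Row \<open>j\<close> of the grid holds infinitely many copies of
    \<open>x j\<close>. The witness is the sum of \<open>a\<close>, which does not depend on
    \<open>i\<close>.\<close>
  define a where "a = (\<lambda>n. x (fst (prod_decode n)))"
  define sum where "sum b = family_sum S (nat_family \<nu> b)" for b
  fix i
  let ?b = "\<lambda>n. a (cycle_row i n)"
  have "sum a = sum ?b"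
    unfolding sum_def using permutation[OF all_summable bij_cycle_row] by simp
  also have "\<dots> = ?b 0 + sum (\<lambda>n. ?b (n + 1))"
    unfolding sum_def using shift[OF all_summable] by blast
  \<comment> \<open>Index 0 lands in row \<open>i\<close>, so \<open>?b 0\<close> is
    \<open>x i\<close>; the tail of \<open>?b\<close> is \<open>a\<close> itself.\<close>
  also have "\<dots> = x i + sum a"
    by (simp add: a_def row_cycle_row_Suc)
  finally show "x i + family_sum S (nat_family \<nu> (\<lambda>n. x (fst (prod_decode n)))) =
      family_sum S (nat_family \<nu> (\<lambda>n. x (fst (prod_decode n))))"
    unfolding sum_def a_def by simp
qed

end
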